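(* (a) If $p$ is an odd prime and $G$ is an uncountable nilpotent $p$-group of class $2$, then $|\Omega_1(G)|=|G|$. (b) For each infinite cardinal $m$ there is a nilpotent $2$-group $G$ of class $2$ with $|G|=2^m$ and $|\Omega_1(G)|=2^{<m}$.
   Context: For a $p$-group $G$, $\Omega_1(G)$ is the subgroup generated by all elements of order $p$. For an infinite cardinal $m$, $2^{<m}=\sum_{n<m}2^n$ (sum over cardinals $n<m$). *)

theory Defs
  imports
    "HOL-Algebra.Multiplicative_Group"
    "HOL-Algebra.Generated_Groups"
    "HOL-Library.Countable_Set"
    "HOL-Computational_Algebra.Primes"
begin

unbundle cardinal_syntax

text \<open>
  Groups may be infinite. In HOL-Algebra an element of infinite order has \<open>ord\<close> equal to 0,
  which is not a power of a prime, so \<open>p_group\<close> forces every element to have finite order.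
\<close>

definition p_group :: "nat \<Rightarrow> ('a, 'm) monoid_scheme \<Rightarrow> bool" where
  "p_group p G \<longleftrightarrow> group G \<and> (\<forall>x \<in> carrier G. \<exists>k. group.ord G x = p ^ k)"

definition Omega1 :: "nat \<Rightarrow> ('a, 'm) monoid_scheme \<Rightarrow> 'a set" where
  "Omega1 p G = generate G {x \<in> carrier G. group.ord G x = p}"

fun lower_central :: "('a, 'm) monoid_scheme \<Rightarrow> nat \<Rightarrow> 'a set" where
  "lower_central G 0 = carrier G"
| "lower_central G (Suc i) =
     generate G (\<Union>h \<in> lower_central G i. \<Union>g \<in> carrier G.
       {h \<otimes>\<^bsub>G\<^esub> g \<otimes>\<^bsub>G\<^esub> inv\<^bsub>G\<^esub> h \<otimes>\<^bsub>G\<^esub> inv\<^bsub>G\<^esub> g})"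

text \<open>
  The class is the exact length of the lower central series. Indexing starts at 0, so class 1 means
  nontrivial abelian, and a group of class 2 is not abelian.
\<close>

definition nilpotent_of_class :: "('a, 'm) monoid_scheme \<Rightarrow> nat \<Rightarrow> bool" where
  "nilpotent_of_class G c \<longleftrightarrow>
     group G \<and> lower_central G c = {\<one>\<^bsub>G\<^esub>} \<and> (\<forall>i<c. lower_central G i \<noteq> {\<one>\<^bsub>G\<^esub>})"

text \<open>
  A cardinal \<open>m\<close> is a cardinal order. Each cardinal \<open>n <o m\<close> is represented by the unique
  \<open>a \<in> Field m\<close> for which the initial segment of \<open>m\<close> strictly below \<open>a\<close> is a cardinal order
  isomorphic to \<open>n\<close> (lemmas \<open>cardinals_below_less\<close> and \<open>cardinals_below_unique_rep\<close>).
\<close>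

definition cardinals_below :: "'a rel \<Rightarrow> 'a set" where
  "cardinals_below m = {a \<in> Field m. Card_order (Restr m (underS m a))}"

definition weak_two_power :: "'a rel \<Rightarrow> ('a \<times> ('a \<Rightarrow> bool)) rel" where
  "weak_two_power m = (CSUM a : |cardinals_below m|. ctwo ^c Restr m (underS m a))"

lemma cardinals_below_less:
  assumes "Card_order m" and "a \<in> cardinals_below m"
  shows "Restr m (underS m a) <o m"
  using assms underS_Restr_ordLess[of m a]
  by (auto simp: cardinals_below_def card_order_on_def)

lemma Restr_underS_ordLess:
  assumes "Well_order r" and b: "b \<in> Field r" and a: "a \<in> underS r b"
  shows "Restr r (underS r a) <o Restr r (underS r b)"
proof -
  have wo: "wo_rel r"
    using assms(1) by (simp add: wo_rel_def)
  let ?p = "Restr r (underS r b)"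
  have F: "Field ?p = underS r b"
    using wo_rel.underS_ofilter[OF wo] Field_Restr_ofilter[OF assms(1)] by blast
  have wp: "Well_order ?p"
    using assms(1) Well_order_Restr by blast
  have sub: "underS r a \<subseteq> underS r b"
    using a underS_incr[OF wo_rel.TRANS[OF wo] wo_rel.ANTISYM[OF wo], of a b] by (auto simp: underS_def)
  have "underS ?p a = underS r a"
    using sub a by (auto simp: underS_def)
  then have "Restr ?p (underS ?p a) = Restr r (underS r a)"
    using sub by auto
  moreover have "Restr ?p (underS ?p a) <o ?p"
    using underS_Restr_ordLess[OF wp, of a] F a by (metis empty_iff)
  ultimately show ?thesis by simp
qed

lemma cardinals_below_unique_rep:
  assumes m: "Card_order m" and n: "Card_order n" and less: "n <o m"
  shows "\<exists>!a. a \<in> cardinals_below m \<and> n =o Restr m (underS m a)"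
proof -
  have wm: "Well_order m" and wn: "Well_order n"
    using m n by (auto simp: card_order_on_def)
  have wo: "wo_rel m"
    using wm by (simp add: wo_rel_def)
  obtain a where a: "a \<in> Field m" and iso: "n =o Restr m (underS m a)"
    using less ordLess_iff_ordIso_Restr[OF wm wn] by blast
  have "Card_order (Restr m (underS m a))"
    using Card_order_ordIso2[OF n iso] .
  then have 1: "a \<in> cardinals_below m"
    using a by (simp add: cardinals_below_def)
  have "b = a" if b: "b \<in> cardinals_below m" and iso': "n =o Restr m (underS m b)" for b
  proof (rule ccontr)
    assume "b \<noteq> a"
    have bF: "b \<in> Field m"
      using b by (simp add: cardinals_below_def)
    have "a \<in> underS m b \<or> b \<in> underS m a"
      using wo_rel.TOTALS[OF wo] a bF \<open>b \<noteq> a\<close> by (auto simp: underS_def)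
    moreover have "Restr m (underS m a) =o Restr m (underS m b)"
      using iso iso' ordIso_symmetric ordIso_transitive by blast
    ultimately show False
      using Restr_underS_ordLess[OF wm] a bF not_ordLess_ordIso ordIso_symmetric by metis
  qed
  with 1 iso show ?thesis by blast
qed

end

theory Submission
  imports
    Defs
    "HOL-Algebra.Free_Abelian_Groups"
    "HOL-Algebra.Weak_Morphisms"
    "HOL-Library.Countable_Set_Type"
begin

text \<open>
  (a) For odd \<open>p\<close> and class 2, \<open>x\<^sup>p = y\<^sup>p\<close> forces \<open>(x y\<inverse>)\<^sup>p = 1\<close>, since the
  commutator \<open>c\<close> of \<open>y\<inverse>\<close> and \<open>x\<close> satisfies \<open>c\<^sup>p = 1\<close> and enters the
  \<open>p\<close>-th power of \<open>x y\<inverse>\<close> with exponent \<open>p (p - 1) / 2\<close>. Hence all fibres of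
  \<open>x \<mapsto> x\<^sup>p\<close> have at most \<open>|\<Omega>\<^sub>1|\<close> elements, and iterating the map bounds \<open>|G|\<close> by
  \<open>\<aleph>\<^sub>0 |\<Omega>\<^sub>1|\<close>.

  (b) Let \<open>V\<close> be the \<open>\<bbbF>\<^sub>2\<close>-space whose basis is the set of branches of the binary tree of
  height \<open>m\<close>, and \<open>N\<close> the \<open>\<bbbF>\<^sub>2\<close>-space whose basis consists of the nodes of the tree
  and one further vector \<open>z\<close>. Sending distinct branches \<open>b < c\<close> to the node where they split,
  \<open>b > c\<close> to 0 and \<open>(b, b)\<close> to \<open>z\<close> extends to a bilinear cocycle \<open>\<beta>\<close>, and
  squaring in the resulting extension of \<open>V\<close> by \<open>N\<close> sends \<open>(v, n)\<close> to
  \<open>(0, \<beta>(v, v))\<close>. As \<open>\<beta>(v, v) \<noteq> 0\<close> for \<open>v \<noteq> 0\<close>, the involutions are exactly the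
  nonzero elements of \<open>N\<close>.
\<close>

section \<open>Odd primes\<close>

text \<open>Each \<open>u\<close> that moves past \<open>x\<close> leaves one central factor
  \<open>c\<close> behind. Collecting all \<open>x\<close> on the left therefore produces 0 + 1 +
  ... + (n - 1) of them, the exponent in the second formula.\<close>

lemma (in group) pow_mult_central_commutator:
  assumes x: "x \<in> carrier G" and u: "u \<in> carrier G" and c: "c \<in> carrier G"
    and central: "\<And>g. g \<in> carrier G \<Longrightarrow> c \<otimes> g = g \<otimes> c"
    and ux: "u \<otimes> x = x \<otimes> u \<otimes> c"
  shows "u [^] n \<otimes> x = x \<otimes> u [^] n \<otimes> c [^] (n::nat)" (is ?swap)
    and "(x \<otimes> u) [^] n = x [^] n \<otimes> u [^] n \<otimes> c [^] (n * (n - 1) div 2)" (is ?pow)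
proof -
  have cpow: "c [^] k \<otimes> g = g \<otimes> c [^] k" if "g \<in> carrier G" for g and k :: nat
    using that c central by (intro group_commutes_pow) auto
  have swap: "u [^] k \<otimes> x = x \<otimes> u [^] k \<otimes> c [^] k" for k :: nat
  proof (induction k)
    case 0
    then show ?case using x by simp
  next
    case (Suc k)
    have "u [^] Suc k \<otimes> x = u [^] k \<otimes> (u \<otimes> x)"
      using x u by (simp add: m_assoc)
    also have "\<dots> = (u [^] k \<otimes> x) \<otimes> (u \<otimes> c)"
      using x u c by (simp add: ux m_assoc)
    also have "\<dots> = x \<otimes> (u [^] k \<otimes> (c [^] k \<otimes> u) \<otimes> c)"
      using x u c by (simp add: Suc m_assoc)
    also have "\<dots> = x \<otimes> u [^] Suc k \<otimes> c [^] Suc k"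
      using x u c by (simp add: cpow[OF u] m_assoc)
    finally show ?case .
  qed
  show ?swap by (rule swap)
  show ?pow
  proof (induction n)
    case 0
    then show ?case by simp
  next
    case (Suc n)
    let ?t = "n * (n - 1) div 2"
    have "(x \<otimes> u) [^] Suc n = x [^] n \<otimes> u [^] n \<otimes> (c [^] ?t \<otimes> (x \<otimes> u))"
      using x u c by (simp add: Suc m_assoc)
    also have "\<dots> = x [^] n \<otimes> (u [^] n \<otimes> x) \<otimes> u \<otimes> c [^] ?t"
      using x u c by (simp add: cpow m_assoc)
    also have "\<dots> = x [^] n \<otimes> x \<otimes> u [^] n \<otimes> (c [^] n \<otimes> u) \<otimes> c [^] ?t"
      using x u c by (simp add: swap m_assoc)
    also have "\<dots> = x [^] Suc n \<otimes> u [^] Suc n \<otimes> c [^] (n + ?t)"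
      using x u c by (simp add: cpow[OF u] m_assoc nat_pow_mult)
    also have "n + ?t = Suc n * (Suc n - 1) div 2"
      by (cases n) auto
    finally show ?case .
  qed
qed

lemma (in group) pow_eq_imp_div_pow_eq_one:
  fixes n :: nat
  assumes "odd n" and x: "x \<in> carrier G" and y: "y \<in> carrier G" and eq: "x [^] n = y [^] n"
    and central: "\<And>a b g. \<lbrakk>a \<in> carrier G; b \<in> carrier G; g \<in> carrier G\<rbrakk>
      \<Longrightarrow> (a \<otimes> b \<otimes> inv a \<otimes> inv b) \<otimes> g = g \<otimes> (a \<otimes> b \<otimes> inv a \<otimes> inv b)"
  shows "(x \<otimes> inv y) [^] n = \<one>"
proof -
  define u where "u = inv y"
  define c where "c = u \<otimes> x \<otimes> inv u \<otimes> inv x"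
  have u: "u \<in> carrier G" and c: "c \<in> carrier G"
    using x y by (auto simp: u_def c_def)
  have cc: "c \<otimes> g = g \<otimes> c" if "g \<in> carrier G" for g
    using central[OF u x that] by (simp add: c_def)
  have "inv x \<otimes> (x \<otimes> u) = u"
    using u x by (simp flip: m_assoc)
  then have "u \<otimes> x = c \<otimes> (x \<otimes> u)"
    using u x by (simp add: c_def m_assoc)
  then have ux: "u \<otimes> x = x \<otimes> u \<otimes> c"
    using cc u x by simp
  note P = pow_mult_central_commutator[OF x u c cc ux]
  have un: "u [^] n = inv (x [^] n)"
    using y by (simp add: u_def eq nat_pow_inv)
  \<comment> \<open>Since \<open>u [^] n\<close> is the inverse of a power of \<open>x\<close>, it
    commutes with \<open>x\<close>. Comparison with the first formula kills
    \<open>c [^] n\<close>.\<close>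
  have "x \<otimes> u [^] n \<otimes> c [^] n = u [^] n \<otimes> x"
    using P(1) by simp
  also have "\<dots> = x \<otimes> u [^] n"
    using x group_commutes_pow[of "inv x" x n] by (simp add: un flip: nat_pow_inv)
  finally have cn: "c [^] n = \<one>"
    using x u c by simp
  \<comment> \<open>Oddness makes \<open>n * (n - 1) div 2\<close> a multiple of \<open>n\<close>,
    so the remaining power of \<open>c\<close> vanishes.\<close>
  obtain k where "n = 2 * k + 1"
    using \<open>odd n\<close> by (rule oddE)
  then have k: "n * (n - 1) div 2 = n * k"
    by simp
  have "(x \<otimes> u) [^] n = x [^] n \<otimes> u [^] n \<otimes> (c [^] n) [^] k"
    using P(2)[of n] c unfolding k by (simp add: nat_pow_pow)
  then show ?thesis
    using x by (simp add: cn un flip: u_def)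
qed

lemma (in group) commutator_eq_one_iff:
  assumes x: "x \<in> carrier G" and y: "y \<in> carrier G"
  shows "x \<otimes> y \<otimes> inv x \<otimes> inv y = \<one> \<longleftrightarrow> x \<otimes> y = y \<otimes> x"
proof -
  have eq: "x \<otimes> y \<otimes> inv x \<otimes> inv y = (x \<otimes> y) \<otimes> inv (y \<otimes> x)"
    using x y by (simp add: inv_mult_group m_assoc)
  have "\<one> = (x \<otimes> y) \<otimes> inv (y \<otimes> x) \<longleftrightarrow> x \<otimes> y = \<one> \<otimes> (y \<otimes> x)"
    using x y by (intro inv_solve_right) auto
  also have "\<one> \<otimes> (y \<otimes> x) = y \<otimes> x"
    using x y by simp
  finally show ?thesis
    unfolding eq by (subst eq_commute)
qed

text \<open>A commutator lies in term 1 of the lower central series, so its commutator with any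
  \<open>g\<close> lies in term 2, which is trivial.\<close>

lemma (in group) class_two_commutators_central:
  assumes "lower_central G 2 = {\<one>}"
    and a: "a \<in> carrier G" and b: "b \<in> carrier G" and g: "g \<in> carrier G"
  shows "(a \<otimes> b \<otimes> inv a \<otimes> inv b) \<otimes> g = g \<otimes> (a \<otimes> b \<otimes> inv a \<otimes> inv b)"
proof -
  let ?c = "a \<otimes> b \<otimes> inv a \<otimes> inv b"
  have c: "?c \<in> carrier G"
    using a b by simp
  have "?c \<in> lower_central G (Suc 0)"
    using a b by (auto intro!: generate.incl)
  then have "?c \<otimes> g \<otimes> inv ?c \<otimes> inv g \<in> lower_central G (Suc (Suc 0))"
    using g unfolding lower_central.simps(2)[of G "Suc 0"] by (intro generate.incl) blast
  then have "?c \<otimes> g \<otimes> inv ?c \<otimes> inv g = \<one>"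
    using assms(1) by (simp add: numeral_2_eq_2)
  then show ?thesis
    by (simp only: commutator_eq_one_iff[OF c g])
qed

lemma Omega1_subset_carrier:
  assumes "group G"
  shows "Omega1 p G \<subseteq> carrier G"
  unfolding Omega1_def using assms by (intro group.generate_incl) auto

lemma card_Omega1_odd:
  fixes G :: "('a, 'x) monoid_scheme"
  assumes p: "prime p" "odd p" and pg: "p_group p G" and nil: "nilpotent_of_class G 2"
    and unc: "uncountable (carrier G)"
  shows "|Omega1 p G| =o |carrier G|"
proof -
  interpret group G
    using nil by (simp add: nilpotent_of_class_def)
  have lc: "lower_central G 2 = {\<one>\<^bsub>G\<^esub>}"
    using nil by (simp add: nilpotent_of_class_def)
  define T where "T n = {x \<in> carrier G. x [^]\<^bsub>G\<^esub> (p ^ n) = \<one>\<^bsub>G\<^esub>}" for n :: nat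
  \<comment> \<open>The factor of natural numbers makes \<open>X\<close> infinite before anything is
    known about the size of \<open>T 1\<close>, and it absorbs the countable union over
    \<open>n\<close>.\<close>
  define X where "X = T 1 \<times> (UNIV :: nat set)"
  have one: "\<one>\<^bsub>G\<^esub> \<in> T 1"
    by (simp add: T_def)
  then have infX: "infinite X"
    by (auto simp: X_def finite_cartesian_product_iff)
  have T1X: "|T 1| \<le>o |X|"
    unfolding X_def by (rule card_of_Times1) simp
  have fibre: "|{y \<in> carrier G. y [^]\<^bsub>G\<^esub> p = z}| \<le>o |T 1|" (is "|?F| \<le>o _") for z
  proof (cases "?F = {}")
    case False
    then obtain x where x: "x \<in> carrier G" "x [^]\<^bsub>G\<^esub> p = z"
      by auto
    \<comment> \<open>Quotients of elements with equal \<open>p\<close>-th powers lie in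
      \<open>T 1\<close>, so dividing a fixed member of the fibre by the others embeds the fibre
      there.\<close>
    have "inj_on (\<lambda>y. x \<otimes>\<^bsub>G\<^esub> inv\<^bsub>G\<^esub> y) ?F"
      using x(1) by (auto intro!: inj_onI)
    moreover have "(\<lambda>y. x \<otimes>\<^bsub>G\<^esub> inv\<^bsub>G\<^esub> y) ` ?F \<subseteq> T 1"
      using x pow_eq_imp_div_pow_eq_one[OF p(2) x(1) _ _ class_two_commutators_central[OF lc]]
      by (auto simp: T_def)
    ultimately show ?thesis
      using card_of_ordLeq by blast
  qed (simp only: card_of_empty)
  have TX: "|T n| \<le>o |X|" for n
  proof (induction n)
    case 0
    have "T 0 \<subseteq> T 1"
      by (auto simp: T_def)
    then show ?case
      using T1X card_of_mono1 ordLeq_transitive by blast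
  next
    case (Suc n)
    \<comment> \<open>The \<open>p\<close>-th power map sends \<open>T (Suc n)\<close> into
      \<open>T n\<close>, so \<open>T (Suc n)\<close> is covered by at most \<open>|X|\<close>
      fibres, each of size at most \<open>|T 1|\<close>.\<close>
    have "T (Suc n) \<subseteq> (\<Union>z \<in> T n. {y \<in> carrier G. y [^]\<^bsub>G\<^esub> p = z})"
      by (auto simp: T_def nat_pow_pow)
    moreover have "|\<Union>z \<in> T n. {y \<in> carrier G. y [^]\<^bsub>G\<^esub> p = z}| \<le>o |X|"
      using fibre T1X ordLeq_transitive by (intro card_of_UNION_ordLeq_infinite[OF infX Suc]) blast
    ultimately show ?case
      using card_of_mono1 ordLeq_transitive by blast
  qed
  have "carrier G \<subseteq> (\<Union>n. T n)"
  proof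
    fix x assume x: "x \<in> carrier G"
    with pg obtain k where "ord x = p ^ k"
      by (auto simp: p_group_def)
    with x have "x \<in> T k"
      by (simp add: T_def pow_eq_id)
    then show "x \<in> (\<Union>n. T n)"
      by blast
  qed
  moreover have "|\<Union>n. T n| \<le>o |X|"
    using TX infX by (intro card_of_UNION_ordLeq_infinite) (auto simp flip: infinite_iff_card_of_nat)
  ultimately have GX: "|carrier G| \<le>o |X|"
    using card_of_mono1 ordLeq_transitive by blast
  have "uncountable (T 1)"
  proof
    assume "countable (T 1)"
    then have "countable X"
      unfolding X_def by simp
    then show False
      using unc countable_ordLeq[OF GX] by simp
  qed
  then have "infinite (T 1)"
    using countable_finite by blast
  then have "|X| =o |T 1|"
    unfolding X_def by (intro card_of_Times_infinite_simps) (auto simp flip: infinite_iff_card_of_nat)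
  moreover have "T 1 \<subseteq> Omega1 p G"
  proof
    fix x assume x: "x \<in> T 1"
    then have xG: "x \<in> carrier G" and "x [^]\<^bsub>G\<^esub> p = \<one>\<^bsub>G\<^esub>"
      by (auto simp: T_def)
    then have "ord x dvd p"
      using pow_eq_id by blast
    then have "x = \<one>\<^bsub>G\<^esub> \<or> ord x = p"
      using p(1) ord_eq_1[OF xG] by (auto simp: prime_nat_iff)
    then show "x \<in> Omega1 p G"
      using xG unfolding Omega1_def by (auto intro: generate.one generate.incl)
  qed
  ultimately have "|carrier G| \<le>o |Omega1 p G|"
    using ordLeq_transitive[OF ordLeq_ordIso_trans[OF GX] card_of_mono1] by blast
  moreover have "|Omega1 p G| \<le>o |carrier G|"
    using Omega1_subset_carrier[OF is_group] by (rule card_of_mono1)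
  ultimately show ?thesis
    by (simp add: ordIso_iff_ordLeq)
qed

section \<open>The extension group of an anisotropic bilinear map\<close>

definition sdiff :: "'a set \<Rightarrow> 'a set \<Rightarrow> 'a set" (infixl "\<triangle>" 65) where
  "A \<triangle> B = (A - B) \<union> (B - A)"

lemma mem_sdiff: "x \<in> A \<triangle> B \<longleftrightarrow> (x \<in> A) \<noteq> (x \<in> B)"
  by (auto simp: sdiff_def)

lemma sdiff_assoc: "A \<triangle> B \<triangle> C = A \<triangle> (B \<triangle> C)"
  and sdiff_commute: "A \<triangle> B = B \<triangle> A"
  and sdiff_left_commute: "A \<triangle> (B \<triangle> C) = B \<triangle> (A \<triangle> C)"
  and sdiff_empty [simp]: "A \<triangle> {} = A" "{} \<triangle> A = A"
  and sdiff_self [simp]: "A \<triangle> A = {}"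
  and sdiff_eq_empty_iff: "A \<triangle> B = {} \<longleftrightarrow> A = B"
  by (auto simp: sdiff_def)

lemma sdiff_left_self [simp]: "A \<triangle> (A \<triangle> B) = B"
  by (simp flip: sdiff_assoc)

lemmas sdiff_ac = sdiff_assoc sdiff_commute sdiff_left_commute

text \<open>The sum of the two cardinalities counts \<open>A \<inter> B\<close> twice. Parity is
  thus additive, which is the source of the bilinearity of \<open>pairing\<close>.\<close>

lemma odd_card_sdiff:
  assumes "finite A" "finite B"
  shows "odd (card (A \<triangle> B)) \<longleftrightarrow> odd (card A) \<noteq> odd (card B)"
proof -
  have "card A = card (A - B) + card (A \<inter> B)" "card B = card (B - A) + card (A \<inter> B)"
    using assms by (auto simp: card_Diff_subset_Int Int_commute card_mono)
  moreover have "card (A \<triangle> B) = card (A - B) + card (B - A)"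
    unfolding sdiff_def using assms by (intro card_Un_disjoint) auto
  ultimately show ?thesis by auto
qed

lemma sdiff_in_Fpow: "\<lbrakk>E \<in> Fpow A; F \<in> Fpow A\<rbrakk> \<Longrightarrow> E \<triangle> F \<in> Fpow A"
  by (auto simp: Fpow_def sdiff_def)

text \<open>
  Finite sets under symmetric difference are the vectors of an \<open>\<bbbF>\<^sub>2\<close>-space with the points as
  basis; \<open>pairing K\<close> is the bilinear map sending a pair \<open>(b, c)\<close> of basis vectors to
  \<open>{k. K b c k}\<close>.
\<close>

definition pairing :: "('v \<Rightarrow> 'v \<Rightarrow> 'k \<Rightarrow> bool) \<Rightarrow> 'v set \<Rightarrow> 'v set \<Rightarrow> 'k set" where
  "pairing K E F = {k. odd (card {(b, c) \<in> E \<times> F. K b c k})}"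

lemma pairing_empty [simp]: "pairing K {} F = {}" "pairing K E {} = {}"
  by (auto simp: pairing_def)

lemma pairing_singleton: "pairing K {b} {c} = {k. K b c k}"
proof -
  have "{(x, y) \<in> {b} \<times> {c}. K x y k} = (if K b c k then {(b, c)} else {})" for k
    by auto
  then show ?thesis
    by (auto simp: pairing_def)
qed

lemma pairing_sdiff_left:
  assumes "finite E" "finite E'" "finite F"
  shows "pairing K (E \<triangle> E') F = pairing K E F \<triangle> pairing K E' F"
proof -
  have "odd (card {(b, c) \<in> (E \<triangle> E') \<times> F. K b c k}) \<longleftrightarrow>
    odd (card {(b, c) \<in> E \<times> F. K b c k}) \<noteq> odd (card {(b, c) \<in> E' \<times> F. K b c k})" for k
  proof -
    have "{(b, c) \<in> (E \<triangle> E') \<times> F. K b c k} =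
      {(b, c) \<in> E \<times> F. K b c k} \<triangle> {(b, c) \<in> E' \<times> F. K b c k}"
      by (auto simp: sdiff_def)
    moreover have "finite {(b, c) \<in> D \<times> F. K b c k}" if "finite D" for D
      using assms that by (auto intro: finite_subset[of _ "D \<times> F"])
    ultimately show ?thesis
      using assms by (simp only: odd_card_sdiff)
  qed
  then show ?thesis
    unfolding pairing_def by (intro Set.set_eqI) (simp only: mem_Collect_eq mem_sdiff)
qed

lemma pairing_sdiff_right:
  assumes "finite E" "finite F" "finite F'"
  shows "pairing K E (F \<triangle> F') = pairing K E F \<triangle> pairing K E F'"
proof -
  have "odd (card {(b, c) \<in> E \<times> (F \<triangle> F'). K b c k}) \<longleftrightarrow>
    odd (card {(b, c) \<in> E \<times> F. K b c k}) \<noteq> odd (card {(b, c) \<in> E \<times> F'. K b c k})" for k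
  proof -
    have "{(b, c) \<in> E \<times> (F \<triangle> F'). K b c k} =
      {(b, c) \<in> E \<times> F. K b c k} \<triangle> {(b, c) \<in> E \<times> F'. K b c k}"
      by (auto simp: sdiff_def)
    moreover have "finite {(b, c) \<in> E \<times> D. K b c k}" if "finite D" for D
      using assms that by (auto intro: finite_subset[of _ "E \<times> D"])
    ultimately show ?thesis
      using assms by (simp only: odd_card_sdiff)
  qed
  then show ?thesis
    unfolding pairing_def by (intro Set.set_eqI) (simp only: mem_Collect_eq mem_sdiff)
qed

text \<open>An odd count is positive, so every \<open>k\<close> in the pairing stems from one of
  finitely many pairs, each of which contributes finitely many values.\<close>

lemma pairing_in_Fpow:
  assumes "E \<in> Fpow B" "F \<in> Fpow B"
    and "\<And>b c. \<lbrakk>b \<in> B; c \<in> B\<rbrakk> \<Longrightarrow> {k. K b c k} \<in> Fpow N"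
  shows "pairing K E F \<in> Fpow N"
proof -
  have "pairing K E F \<subseteq> (\<Union>b\<in>E. \<Union>c\<in>F. {k. K b c k})"
  proof
    fix k assume "k \<in> pairing K E F"
    then have "0 < card {(b, c) \<in> E \<times> F. K b c k}"
      unfolding pairing_def mem_Collect_eq by (rule odd_pos)
    then have "{(b, c) \<in> E \<times> F. K b c k} \<noteq> {}"
      unfolding card_gt_0_iff by simp
    then show "k \<in> (\<Union>b\<in>E. \<Union>c\<in>F. {k. K b c k})"
      by blast
  qed
  moreover have "(\<Union>b\<in>E. \<Union>c\<in>F. {k. K b c k}) \<subseteq> N"
    using assms unfolding Fpow_def by blast
  moreover have "finite (\<Union>b\<in>E. \<Union>c\<in>F. {k. K b c k})"
    using assms unfolding Fpow_def by blast
  ultimately show ?thesis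
    unfolding Fpow_def by (blast intro: finite_subset)
qed

section \<open>The central extension and its invariants\<close>

definition pairing_group ::
    "('v \<Rightarrow> 'v \<Rightarrow> 'k \<Rightarrow> bool) \<Rightarrow> 'v set \<Rightarrow> 'k set \<Rightarrow> ('v set \<times> 'k set) monoid" where
  "pairing_group K B N =
     \<lparr>carrier = Fpow B \<times> Fpow N,
      monoid.mult = (\<lambda>(E, S) (F, T). (E \<triangle> F, S \<triangle> T \<triangle> pairing K E F)),
      monoid.one = ({}, {})\<rparr>"

text \<open>The first assumption makes the cocycle take values in \<open>Fpow N\<close>, the second
  makes squares of elements outside the central subgroup \<open>Z\<close> nontrivial, and the third
  makes the group nonabelian.\<close>

locale anisotropic_pairing =
  fixes K :: "'v \<Rightarrow> 'v \<Rightarrow> 'k \<Rightarrow> bool" and B :: "'v set" and N :: "'k set"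
  assumes finite_values: "\<And>b c. \<lbrakk>b \<in> B; c \<in> B\<rbrakk> \<Longrightarrow> {k. K b c k} \<in> Fpow N"
    and anisotropic: "\<And>E. \<lbrakk>E \<in> Fpow B; E \<noteq> {}\<rbrakk> \<Longrightarrow> pairing K E E \<noteq> {}"
    and asymmetric: "\<exists>b \<in> B. \<exists>c \<in> B. \<exists>k. K b c k \<noteq> K c b k"
begin

abbreviation "G \<equiv> pairing_group K B N"

lemma carrier_G: "carrier G = Fpow B \<times> Fpow N"
  and mult_G: "(E, S) \<otimes>\<^bsub>G\<^esub> (F, T) = (E \<triangle> F, S \<triangle> T \<triangle> pairing K E F)"
  and one_G: "\<one>\<^bsub>G\<^esub> = ({}, {})"
  by (simp_all add: pairing_group_def)

lemma pairing_closed: "\<lbrakk>E \<in> Fpow B; F \<in> Fpow B\<rbrakk> \<Longrightarrow> pairing K E F \<in> Fpow N"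
  by (rule pairing_in_Fpow[OF _ _ finite_values])

lemma group_G: "group G"
proof (rule groupI)
  fix x y assume "x \<in> carrier G" "y \<in> carrier G"
  then show "x \<otimes>\<^bsub>G\<^esub> y \<in> carrier G"
    by (cases x; cases y) (simp add: carrier_G mult_G sdiff_in_Fpow pairing_closed)
next
  show "\<one>\<^bsub>G\<^esub> \<in> carrier G"
    by (simp add: carrier_G one_G empty_in_Fpow)
next
  fix x y z assume "x \<in> carrier G" "y \<in> carrier G" "z \<in> carrier G"
  moreover obtain E S F T D U where xyz: "x = (E, S)" "y = (F, T)" "z = (D, U)"
    by (cases x; cases y; cases z)
  ultimately have fin: "finite E" "finite F" "finite D"
    by (auto simp: carrier_G Fpow_def)
  \<comment> \<open>By bilinearity both second components are the sum of \<open>S\<close>,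
    \<open>T\<close>, \<open>U\<close> and the pairings of \<open>E\<close> with \<open>F\<close>,
    \<open>E\<close> with \<open>D\<close> and \<open>F\<close> with \<open>D\<close>.\<close>
  show "x \<otimes>\<^bsub>G\<^esub> y \<otimes>\<^bsub>G\<^esub> z = x \<otimes>\<^bsub>G\<^esub> (y \<otimes>\<^bsub>G\<^esub> z)"
    unfolding xyz mult_G pairing_sdiff_left[OF fin] pairing_sdiff_right[OF fin]
    by (simp add: sdiff_ac)
next
  fix x assume "x \<in> carrier G"
  then show "\<one>\<^bsub>G\<^esub> \<otimes>\<^bsub>G\<^esub> x = x"
    by (cases x) (simp add: one_G mult_G)
next
  fix x assume x: "x \<in> carrier G"
  obtain E S where E: "x = (E, S)" by (cases x)
  \<comment> \<open>The square of \<open>(E, S)\<close> is \<open>({}, pairing K E E)\<close>; the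
    extra term in the inverse cancels it.\<close>
  have "(E, S \<triangle> pairing K E E) \<in> carrier G"
    using x by (simp add: E carrier_G sdiff_in_Fpow pairing_closed)
  moreover have "(E, S \<triangle> pairing K E E) \<otimes>\<^bsub>G\<^esub> x = \<one>\<^bsub>G\<^esub>"
    unfolding E mult_G one_G by (simp add: sdiff_ac)
  ultimately show "\<exists>y\<in>carrier G. y \<otimes>\<^bsub>G\<^esub> x = \<one>\<^bsub>G\<^esub>" ..
qed

sublocale group G by (rule group_G)

lemma square_G: "(E, S) \<otimes>\<^bsub>G\<^esub> (E, S) = ({}, pairing K E E)"
  by (simp add: mult_G)

abbreviation Z :: "('v set \<times> 'k set) set" where
  "Z \<equiv> {{}} \<times> Fpow N"

lemma Z_central:
  assumes "z \<in> Z" "x \<in> carrier G" shows "z \<otimes>\<^bsub>G\<^esub> x = x \<otimes>\<^bsub>G\<^esub> z"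
proof -
  obtain E S T where "x = (E, S)" "z = ({}, T)"
    using assms by (cases x) auto
  then show ?thesis
    by (simp add: mult_G sdiff_commute)
qed

lemma inv_Z:
  assumes "z \<in> Z" shows "inv\<^bsub>G\<^esub> z = z"
proof (rule inv_equality)
  show "z \<otimes>\<^bsub>G\<^esub> z = \<one>\<^bsub>G\<^esub>"
    using assms by (auto simp: mult_G one_G)
  show "z \<in> carrier G" "z \<in> carrier G"
    using assms by (auto simp: carrier_G empty_in_Fpow)
qed

lemma subgroup_Z: "subgroup Z G"
proof (rule subgroupI)
  show "Z \<subseteq> carrier G"
    by (simp add: carrier_G Sigma_mono empty_in_Fpow)
  show "Z \<noteq> {}"
    using empty_in_Fpow by auto
  fix z assume z: "z \<in> Z"
  then show "inv\<^bsub>G\<^esub> z \<in> Z"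
    by (simp only: inv_Z)
  fix y assume "y \<in> Z"
  with z show "z \<otimes>\<^bsub>G\<^esub> y \<in> Z"
    by (auto simp: mult_G sdiff_in_Fpow)
qed

lemma fst_mult_G: "fst (x \<otimes>\<^bsub>G\<^esub> y) = fst x \<triangle> fst y"
  by (cases x; cases y) (simp add: mult_G)

lemma fst_inv_G:
  assumes "x \<in> carrier G"
  shows "fst (inv\<^bsub>G\<^esub> x) = fst x"
proof -
  have "fst x \<triangle> fst (inv\<^bsub>G\<^esub> x) = {}"
    using assms by (metis fst_mult_G r_inv one_G fst_conv)
  then show ?thesis by (simp add: sdiff_eq_empty_iff)
qed

text \<open>The projection \<open>fst\<close> is a homomorphism to an abelian group with kernel
  \<open>Z\<close>.\<close>

lemma commutator_in_Z:
  assumes "x \<in> carrier G" "y \<in> carrier G"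
  shows "x \<otimes>\<^bsub>G\<^esub> y \<otimes>\<^bsub>G\<^esub> inv\<^bsub>G\<^esub> x \<otimes>\<^bsub>G\<^esub> inv\<^bsub>G\<^esub> y \<in> Z" (is "?c \<in> _")
proof -
  have "fst ?c = {}"
    using assms by (simp add: fst_mult_G fst_inv_G sdiff_ac)
  moreover have "?c \<in> carrier G"
    using assms by simp
  ultimately show ?thesis
    by (cases ?c) (auto simp: carrier_G)
qed

lemma nilpotent_G: "nilpotent_of_class G 2"
proof -
  have 1: "lower_central G 1 \<subseteq> Z"
    using commutator_in_Z unfolding One_nat_def lower_central.simps
    by (intro generate_subgroup_incl[OF _ subgroup_Z]) blast
  have trivial: "z \<otimes>\<^bsub>G\<^esub> g \<otimes>\<^bsub>G\<^esub> inv\<^bsub>G\<^esub> z \<otimes>\<^bsub>G\<^esub> inv\<^bsub>G\<^esub> g = \<one>\<^bsub>G\<^esub>" if "z \<in> Z" "g \<in> carrier G" for z g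
  proof -
    have "z \<in> carrier G"
      using that by (auto simp: carrier_G empty_in_Fpow)
    then show ?thesis
      using that Z_central[OF that] by (simp add: m_assoc)
  qed
  have "generate G (\<Union>h \<in> lower_central G 1. \<Union>g \<in> carrier G.
      {h \<otimes>\<^bsub>G\<^esub> g \<otimes>\<^bsub>G\<^esub> inv\<^bsub>G\<^esub> h \<otimes>\<^bsub>G\<^esub> inv\<^bsub>G\<^esub> g}) \<subseteq> {\<one>\<^bsub>G\<^esub>}"
    using 1 trivial by (intro generate_subgroup_incl triv_subgroup) blast
  then have 2: "lower_central G 2 = {\<one>\<^bsub>G\<^esub>}"
    by (auto simp: numeral_2_eq_2 intro: generate.one)
  \<comment> \<open>Two basis vectors on which \<open>K\<close> is not symmetric give noncommuting
    elements, so the class is not smaller than 2.\<close>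
  obtain b c k where bc: "b \<in> B" "c \<in> B" "K b c k \<noteq> K c b k"
    using asymmetric by blast
  define x y where "x = ({b}, {} :: 'k set)" and "y = ({c}, {} :: 'k set)"
  have x: "x \<in> carrier G" and y: "y \<in> carrier G"
    using bc by (auto simp: x_def y_def carrier_G Fpow_def)
  have ne: "x \<otimes>\<^bsub>G\<^esub> y \<noteq> y \<otimes>\<^bsub>G\<^esub> x"
    using bc(3) by (auto simp: x_def y_def mult_G pairing_singleton)
  have "x \<otimes>\<^bsub>G\<^esub> y \<otimes>\<^bsub>G\<^esub> inv\<^bsub>G\<^esub> x \<otimes>\<^bsub>G\<^esub> inv\<^bsub>G\<^esub> y \<in> lower_central G 1"
    using x y by (auto intro!: generate.incl)
  moreover have "x \<otimes>\<^bsub>G\<^esub> y \<otimes>\<^bsub>G\<^esub> inv\<^bsub>G\<^esub> x \<otimes>\<^bsub>G\<^esub> inv\<^bsub>G\<^esub> y \<noteq> \<one>\<^bsub>G\<^esub>"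
    using ne by (simp only: commutator_eq_one_iff[OF x y] not_False_eq_True)
  ultimately have "lower_central G 1 \<noteq> {\<one>\<^bsub>G\<^esub>}"
    by auto
  moreover have "x \<noteq> \<one>\<^bsub>G\<^esub>"
    by (simp add: x_def one_G)
  then have "lower_central G 0 \<noteq> {\<one>\<^bsub>G\<^esub>}"
    using x unfolding lower_central.simps by blast
  ultimately show ?thesis
    using 2 by (auto simp: nilpotent_of_class_def less_2_cases_iff)
qed

text \<open>Squares lie in \<open>Z\<close>, where every element squares to the identity, so the
  exponent divides 4.\<close>

lemma p_group_G: "p_group 2 G"
  unfolding p_group_def
proof (intro conjI ballI)
  show "group G" by (rule group_G)
  fix x assume x: "x \<in> carrier G"
  obtain E S where E: "x = (E, S)" by (cases x)
  have "x [^]\<^bsub>G\<^esub> (4::nat) = (x \<otimes>\<^bsub>G\<^esub> x) \<otimes>\<^bsub>G\<^esub> (x \<otimes>\<^bsub>G\<^esub> x)"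
    using x by (simp add: numeral_eq_Suc m_assoc)
  also have "\<dots> = \<one>\<^bsub>G\<^esub>"
    by (simp add: E square_G one_G)
  finally have "ord x dvd 2 ^ 2"
    using x by (simp add: pow_eq_id)
  then show "\<exists>k. ord x = 2 ^ k"
    using divides_primepow_nat two_is_prime_nat by blast
qed

text \<open>By anisotropy an element with nonempty first component has a nontrivial square.
  Conversely every element of \<open>Z\<close> squares to the identity, and \<open>Z\<close> is a
  subgroup.\<close>

lemma Omega1_G: "Omega1 2 G = Z"
proof
  have sq: "x \<otimes>\<^bsub>G\<^esub> x = \<one>\<^bsub>G\<^esub> \<longleftrightarrow> ord x dvd 2" if "x \<in> carrier G" for x
    using that by (simp flip: pow_eq_id add: numeral_2_eq_2)
  show "Omega1 2 G \<subseteq> Z"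
    unfolding Omega1_def
  proof (rule generate_subgroup_incl[OF _ subgroup_Z])
    show "{x \<in> carrier G. ord x = 2} \<subseteq> Z"
    proof
      fix x assume x: "x \<in> {x \<in> carrier G. ord x = 2}"
      obtain E S where E: "x = (E, S)" by (cases x)
      have "pairing K E E = {}"
        using x sq[of x] by (auto simp: E square_G one_G)
      then show "x \<in> Z"
        using x anisotropic[of E] by (auto simp: E carrier_G)
    qed
  qed
  show "Z \<subseteq> Omega1 2 G"
  proof
    fix x assume x: "x \<in> Z"
    then have xG: "x \<in> carrier G"
      using subgroup_Z subgroup.mem_carrier by metis
    have "x \<otimes>\<^bsub>G\<^esub> x = \<one>\<^bsub>G\<^esub>"
      using inv_Z[OF x] xG by (metis r_inv)
    then have "ord x dvd 2"
      using sq xG by simp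
    then have "x = \<one>\<^bsub>G\<^esub> \<or> ord x = 2"
      using xG ord_eq_1 two_is_prime_nat prime_nat_iff by metis
    then show "x \<in> Omega1 2 G"
      using xG unfolding Omega1_def by (auto intro: generate.one generate.incl)
  qed
qed

end

section \<open>Invariance under isomorphism\<close>

lemma (in group) lower_central_subset: "lower_central G i \<subseteq> carrier G"
proof (induction i)
  case (Suc i)
  then show ?case
    unfolding lower_central.simps by (intro generate_incl) blast
qed simp

context
  fixes G :: "('a, 'x) monoid_scheme" and H :: "('b, 'y) monoid_scheme" and h
  assumes G: "group G" and H: "group H" and h: "h \<in> iso G H"
begin

interpretation group_hom G H h
  using G H h by (auto simp: group_hom_def group_hom_axioms_def iso_def)

text \<open>By injectivity the same exponents annihilate \<open>x\<close> and \<open>h x\<close>,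
  and they determine the order.\<close>

lemma iso_ord:
  assumes "x \<in> carrier G"
  shows "group.ord H (h x) = group.ord G x"
proof -
  have inj: "inj_on h (carrier G)"
    using h by (auto simp: iso_def bij_betw_def)
  have "h x [^]\<^bsub>H\<^esub> n = \<one>\<^bsub>H\<^esub> \<longleftrightarrow> x [^]\<^bsub>G\<^esub> n = \<one>\<^bsub>G\<^esub>" for n :: nat
    using assms inj hom_nat_pow[of x n] hom_one
    by (metis G.nat_pow_closed G.one_closed inj_on_eq_iff)
  then show ?thesis
    using assms G.pow_eq_id by (subst H.ord_unique) auto
qed

lemma iso_p_group:
  assumes "p_group p G"
  shows "p_group p H"
proof -
  have "carrier H = h ` carrier G"
    using h by (auto simp: iso_def bij_betw_def)
  then show ?thesis
    using assms H iso_ord by (auto simp: p_group_def)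
qed

lemma iso_Omega1: "Omega1 p H = h ` Omega1 p G"
proof -
  have "carrier H = h ` carrier G"
    using h by (auto simp: iso_def bij_betw_def)
  then have "{y \<in> carrier H. group.ord H y = p} = h ` {x \<in> carrier G. group.ord G x = p}"
    using iso_ord by auto
  then show ?thesis
    unfolding Omega1_def by (simp add: generate_img)
qed

lemma iso_lower_central: "lower_central H i = h ` lower_central G i"
proof (induction i)
  case 0
  show ?case
    using h by (auto simp: iso_def bij_betw_def)
next
  case (Suc i)
  let ?X = "\<Union>x \<in> lower_central G i. \<Union>g \<in> carrier G.
      {x \<otimes>\<^bsub>G\<^esub> g \<otimes>\<^bsub>G\<^esub> inv\<^bsub>G\<^esub> x \<otimes>\<^bsub>G\<^esub> inv\<^bsub>G\<^esub> g}"
  have X: "?X \<subseteq> carrier G"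
    using G.lower_central_subset[of i] by blast
  have "carrier H = h ` carrier G"
    using h by (auto simp: iso_def bij_betw_def)
  moreover have "h (x \<otimes>\<^bsub>G\<^esub> g \<otimes>\<^bsub>G\<^esub> inv\<^bsub>G\<^esub> x \<otimes>\<^bsub>G\<^esub> inv\<^bsub>G\<^esub> g) =
      h x \<otimes>\<^bsub>H\<^esub> h g \<otimes>\<^bsub>H\<^esub> inv\<^bsub>H\<^esub> h x \<otimes>\<^bsub>H\<^esub> inv\<^bsub>H\<^esub> h g"
    if "x \<in> lower_central G i" "g \<in> carrier G" for x g
    using that G.lower_central_subset[of i] by (auto simp: subset_iff)
  ultimately have "(\<Union>x \<in> lower_central H i. \<Union>g \<in> carrier H.
      {x \<otimes>\<^bsub>H\<^esub> g \<otimes>\<^bsub>H\<^esub> inv\<^bsub>H\<^esub> x \<otimes>\<^bsub>H\<^esub> inv\<^bsub>H\<^esub> g}) = h ` ?X"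
    by (simp add: Suc image_UN)
  then show ?case
    using generate_img[OF X] by simp
qed

lemma iso_nilpotent_of_class:
  assumes "nilpotent_of_class G c"
  shows "nilpotent_of_class H c"
proof -
  have inj: "inj_on h (carrier G)"
    using h by (auto simp: iso_def bij_betw_def)
  have "lower_central H i = {\<one>\<^bsub>H\<^esub>} \<longleftrightarrow> lower_central G i = {\<one>\<^bsub>G\<^esub>}" for i
  proof -
    have "h ` lower_central G i = h ` {\<one>\<^bsub>G\<^esub>} \<longleftrightarrow> lower_central G i = {\<one>\<^bsub>G\<^esub>}"
      using inj G.lower_central_subset by (intro inj_on_image_eq_iff[of h "carrier G"]) auto
    then show ?thesis
      by (simp add: iso_lower_central)
  qed
  then show ?thesis
    using assms H by (simp add: nilpotent_of_class_def)
qed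

end

section \<open>Meets in the binary tree\<close>

text \<open>A branch is the set of levels at which it turns to 1. \<open>Some (a, s)\<close> is the
  node at level \<open>a\<close> with history \<open>s\<close> below \<open>a\<close>, and
  \<open>None\<close> is the extra basis vector \<open>z\<close>. Requiring \<open>b\<close> to turn
  to 0 and \<open>c\<close> to 1 orders the two branches.\<close>

definition meet_node :: "'a rel \<Rightarrow> 'a set \<Rightarrow> 'a set \<Rightarrow> ('a \<times> 'a set) option \<Rightarrow> bool" where
  "meet_node r b c k \<longleftrightarrow> (case k of None \<Rightarrow> b = c
     | Some (a, s) \<Rightarrow> a \<notin> b \<and> a \<in> c \<and> b \<inter> underS r a = s \<and> c \<inter> underS r a = s)"

text \<open>The level is recorded along with the history because one set \<open>s\<close> may be a
  subset of many initial segments.\<close>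

definition tree_nodes :: "'a rel \<Rightarrow> ('a \<times> 'a set) option set" where
  "tree_nodes r = insert None (Some ` (SIGMA a : Field r. Pow (underS r a)))"

lemma meet_node_simps [simp]:
  "meet_node r b c None \<longleftrightarrow> b = c"
  "meet_node r b c (Some (a, s)) \<longleftrightarrow>
    a \<notin> b \<and> a \<in> c \<and> b \<inter> underS r a = s \<and> c \<inter> underS r a = s"
  by (simp_all add: meet_node_def)

context
  fixes r :: "'a rel"
  assumes wo: "Well_order r"
begin

lemma underS_cases:
  assumes "a \<in> Field r" "a' \<in> Field r"
  shows "a = a' \<or> a \<in> underS r a' \<or> a' \<in> underS r a"
  using wo_rel.TOTALS[of r] wo assms by (auto simp: underS_def wo_rel_def)

lemma underS_subset:
  assumes "a \<in> underS r a'"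
  shows "underS r a \<subseteq> underS r a'"
  using assms wo_rel.TRANS[of r] wo_rel.ANTISYM[of r] wo
  by (auto simp: underS_def wo_rel_def dest: transD antisymD)

text \<open>The least element of the symmetric difference is the level at which the branches
  split.\<close>

lemma first_difference:
  assumes "b \<subseteq> Field r" "c \<subseteq> Field r" "b \<noteq> c"
  shows "\<exists>a \<in> Field r. (a \<in> b) \<noteq> (a \<in> c) \<and> b \<inter> underS r a = c \<inter> underS r a"
proof -
  have w: "wo_rel r"
    using wo by (simp add: wo_rel_def)
  let ?D = "b - c \<union> (c - b)"
  have D: "?D \<subseteq> Field r" "?D \<noteq> {}"
    using assms by auto
  define a where "a = wo_rel.minim r ?D"
  have a: "a \<in> ?D" and least: "\<And>x. x \<in> ?D \<Longrightarrow> (a, x) \<in> r"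
    using wo_rel.minim_in[OF w D] wo_rel.minim_least[OF w D(1)] by (auto simp: a_def)
  have "x \<notin> ?D" if "x \<in> underS r a" for x
    using least[of x] that wo_rel.ANTISYM[OF w] by (auto simp: underS_def dest: antisymD)
  then have "b \<inter> underS r a = c \<inter> underS r a"
    by blast
  moreover have "a \<in> Field r" "(a \<in> b) \<noteq> (a \<in> c)"
    using a D by auto
  ultimately show ?thesis by blast
qed

text \<open>Each pair has at most one value: of two distinct splitting levels, the lower would lie
  in the segment on which the branches must still agree.\<close>

lemma meet_node_in_Fpow:
  assumes "b \<subseteq> Field r" "c \<subseteq> Field r"
  shows "{k. meet_node r b c k} \<in> Fpow (tree_nodes r)"
proof -
  have unique: "k = k'" if k: "meet_node r b c k" and k': "meet_node r b c k'" for k k'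
  proof (cases k)
    case None
    with k k' show ?thesis by (cases k') auto
  next
    case (Some p)
    obtain a s where p: "p = (a, s)" by (cases p)
    from k Some p k' obtain a' s' where K': "k' = Some (a', s')"
      by (cases k') auto
    have "a \<in> Field r" "a' \<in> Field r"
      using k k' Some p K' assms by auto
    moreover have "a \<notin> underS r a'" "a' \<notin> underS r a"
      using k k' Some p K' by auto
    ultimately have "a = a'"
      using underS_cases by blast
    then show ?thesis
      using k k' Some p K' by auto
  qed
  have "finite {k. meet_node r b c k}"
  proof (cases "\<exists>k. meet_node r b c k")
    case True
    then obtain k where "meet_node r b c k" ..
    with unique have "{k. meet_node r b c k} \<subseteq> {k}"
      by blast
    then show ?thesis
      using finite_subset by blast
  qed simp
  moreover have "k \<in> tree_nodes r" if "meet_node r b c k" for k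
  proof (cases k)
    case (Some p)
    obtain a s where "p = (a, s)" by (cases p)
    then show ?thesis
      using that Some assms by (auto simp: tree_nodes_def)
  qed (simp add: tree_nodes_def)
  ultimately show ?thesis
    by (auto simp: Fpow_def)
qed

text \<open>
  A node of least possible number of branches among the meets of two members of \<open>E\<close> has exactly
  one member of \<open>E\<close> on either side, so its coefficient in \<open>pairing (meet_node r) E E\<close> is 1.
\<close>

lemma meet_node_anisotropic:
  assumes E: "E \<in> Fpow (Pow (Field r))" "E \<noteq> {}"
  shows "pairing (meet_node r) E E \<noteq> {}"
proof (cases "\<exists>b. E = {b}")
  \<comment> \<open>A single branch splits from nothing; here the extra vector \<open>z\<close>
    supplies the nonzero coefficient.\<close>
  case True
  then obtain b where "E = {b}" ..
  then have "None \<in> pairing (meet_node r) E E"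
    by (simp add: pairing_singleton)
  then show ?thesis by blast
next
  case False
  have sub: "b \<subseteq> Field r" if "b \<in> E" for b
    using E(1) that by (auto simp: Fpow_def)
  \<comment> \<open>\<open>L p\<close> collects the members of \<open>E\<close> through the node
    \<open>p\<close>, and \<open>M p\<close> says that members of \<open>E\<close> split
    there.\<close>
  define L where "L p = {b \<in> E. b \<inter> underS r (fst p) = snd p}" for p
  define M where "M p \<longleftrightarrow> fst p \<in> Field r \<and>
    (\<exists>b \<in> L p. fst p \<notin> b) \<and> (\<exists>c \<in> L p. fst p \<in> c)" for p
  have meet: "\<exists>a. M (a, b \<inter> underS r a) \<and> (a \<in> b) \<noteq> (a \<in> c) \<and>
      b \<inter> underS r a = c \<inter> underS r a" if bc: "b \<in> E" "c \<in> E" "b \<noteq> c" for b c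
  proof -
    obtain a where a: "a \<in> Field r" "(a \<in> b) \<noteq> (a \<in> c)" "b \<inter> underS r a = c \<inter> underS r a"
      using first_difference[OF sub sub] bc by blast
    then have "b \<in> L (a, b \<inter> underS r a)" "c \<in> L (a, b \<inter> underS r a)"
      using bc by (auto simp: L_def)
    then have "M (a, b \<inter> underS r a)"
      using a(1,2) unfolding M_def by auto
    with a show ?thesis by blast
  qed
  obtain b0 c0 where "b0 \<in> E" "c0 \<in> E" "b0 \<noteq> c0"
    using E(2) False by blast
  with meet have "\<exists>p. M p" by blast
  then obtain p where p: "M p" and least: "\<And>q. M q \<Longrightarrow> card (L p) \<le> card (L q)"
    using ex_has_least_nat[of M _ "\<lambda>p. card (L p)"] by blast
  obtain a s where as: "p = (a, s)" by (cases p)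
  have a: "a \<in> Field r"
    using p by (simp add: M_def as)
  have finL: "finite (L q)" for q
    using E(1) by (auto simp: L_def Fpow_def)
  \<comment> \<open>Two members on the same side of \<open>a\<close> would split at a higher level
    \<open>a'\<close>. The branches through that node all lie on one side of \<open>a\<close>, so
    they form a proper subset of \<open>L p\<close>, against minimality.\<close>
  have unique: "b = c" if b: "b \<in> L p" and c: "c \<in> L p" and side: "a \<in> b \<longleftrightarrow> a \<in> c" for b c
  proof (rule ccontr)
    assume "b \<noteq> c"
    then obtain a' where a': "M (a', b \<inter> underS r a')" "(a' \<in> b) \<noteq> (a' \<in> c)"
        "b \<inter> underS r a' = c \<inter> underS r a'"
      using meet[OF _ _ \<open>b \<noteq> c\<close>] b c unfolding L_def by blast
    have agree: "b \<inter> underS r a = s" "c \<inter> underS r a = s"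
      using b c by (auto simp: L_def as)
    have "a' \<in> Field r"
      using a'(1) by (simp add: M_def)
    moreover have "a' \<notin> underS r a" "a' \<noteq> a"
      using a'(2) agree side by auto
    ultimately have below: "a \<in> underS r a'"
      using underS_cases a by blast
    have "(a \<in> d \<longleftrightarrow> a \<in> b) \<and> d \<in> L p" if "d \<in> L (a', b \<inter> underS r a')" for d
    proof -
      have d: "d \<in> E" "d \<inter> underS r a' = b \<inter> underS r a'"
        using that by (auto simp: L_def)
      then have "d \<inter> underS r a = b \<inter> underS r a"
        using underS_subset[OF below] by blast
      with d agree below show ?thesis
        by (auto simp: L_def as)
    qed
    moreover have "\<exists>d \<in> L p. (a \<in> d) \<noteq> (a \<in> b)"
      using p by (auto simp: M_def as)
    ultimately have "L (a', b \<inter> underS r a') \<subset> L p"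
      by blast
    then show False
      using least[OF a'(1)] psubset_card_mono[OF finL] by (meson linorder_not_less)
  qed
  obtain b c where b: "b \<in> L p" "a \<notin> b" and c: "c \<in> L p" "a \<in> c"
    using p by (auto simp: M_def as)
  \<comment> \<open>The ordered pairs meeting at \<open>(a, s)\<close> form a product of the two
    sides, each of which is a singleton; the count is therefore 1.\<close>
  have "{(x, y) \<in> E \<times> E. meet_node r x y (Some (a, s))} =
      {x \<in> L p. a \<notin> x} \<times> {y \<in> L p. a \<in> y}"
    by (auto simp: L_def as)
  also have "{x \<in> L p. a \<notin> x} = {b}"
    using unique b by auto
  also have "{y \<in> L p. a \<in> y} = {c}"
    using unique c by auto
  finally have "Some (a, s) \<in> pairing (meet_node r) E E"
    by (simp add: pairing_def)
  then show ?thesis by blast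
qed

lemma anisotropic_pairing_meet_node:
  assumes "Field r \<noteq> {}"
  shows "anisotropic_pairing (meet_node r) (Pow (Field r)) (tree_nodes r)"
proof
  show "{k. meet_node r b c k} \<in> Fpow (tree_nodes r)" if "b \<in> Pow (Field r)" "c \<in> Pow (Field r)" for b c
    using meet_node_in_Fpow that by auto
  show "pairing (meet_node r) E E \<noteq> {}" if "E \<in> Fpow (Pow (Field r))" "E \<noteq> {}" for E
    using meet_node_anisotropic that by auto
  obtain a where a: "a \<in> Field r"
    using assms by blast
  \<comment> \<open>These branches agree below \<open>a\<close>, and only the second one contains
    \<open>a\<close>.\<close>
  have "meet_node r {} {a} (Some (a, {}))" "\<not> meet_node r {a} {} (Some (a, {}))"
    by (auto simp: underS_def)
  with a show "\<exists>b \<in> Pow (Field r). \<exists>c \<in> Pow (Field r). \<exists>k. meet_node r b c k \<noteq> meet_node r c b k"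
    by blast
qed

end

section \<open>The cardinal \<open>2\<^bsup><m\<^esup>\<close>\<close>

lemma card_Pow_Field: "|Pow (Field m)| =o ctwo ^c m"
  unfolding cexp_def ctwo_def by (simp add: card_of_Pow_Func)

context
  fixes m :: "'b rel"
  assumes m: "Cinfinite m"
begin

lemma Field_Restr_underS: "Field (Restr m (underS m a)) = underS m a"
proof -
  have "Well_order m"
    using m card_order_on_well_order_on by blast
  moreover from this have "wo_rel m"
    by (simp only: wo_rel_def)
  ultimately show ?thesis
    by (intro Field_Restr_ofilter wo_rel.underS_ofilter)
qed

lemma infinite_Field: "infinite (Field m)"
  using m unfolding cinfinite_def by blast

text \<open>This replaces any set smaller than \<open>m\<close> by one of the segments that index
  \<open>weak_two_power m\<close>.\<close>

lemma ex_cardinals_below: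
  assumes "|A| <o m"
  shows "\<exists>c \<in> cardinals_below m. |A| =o |underS m c|"
proof -
  obtain c where c: "c \<in> cardinals_below m" "|A| =o Restr m (underS m c)"
    using cardinals_below_unique_rep[of m "|A|"] m assms by auto
  then have "|underS m c| =o Restr m (underS m c)"
    using card_of_Field_ordIso[of "Restr m (underS m c)"]
    by (simp add: Field_Restr_underS cardinals_below_def)
  then have "|A| =o |underS m c|"
    using c(2) ordIso_symmetric ordIso_transitive by blast
  with c(1) show ?thesis by blast
qed

abbreviation segment_subsets :: "('b \<times> 'b set) set" where
  "segment_subsets \<equiv> SIGMA c : cardinals_below m. Pow (underS m c)"

lemma weak_two_power_eq: "|segment_subsets| =o weak_two_power m"
proof -
  have "weak_two_power m = |SIGMA c : cardinals_below m. Func (underS m c) (UNIV :: bool set)|"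
    unfolding weak_two_power_def Csum_def cexp_def ctwo_def Field_card_of Field_Restr_underS by (rule refl)
  moreover have "|segment_subsets| =o |SIGMA c : cardinals_below m. Func (underS m c) (UNIV :: bool set)|"
    using card_of_Pow_Func by (intro card_of_Sigma_cong1) blast
  ultimately show ?thesis
    by (simp only:)
qed

lemma Pow_underS_ordLeq_segment_subsets:
  assumes "c \<in> cardinals_below m"
  shows "|Pow (underS m c)| \<le>o |segment_subsets|"
proof -
  have "inj_on (Pair c) (Pow (underS m c))" "Pair c ` Pow (underS m c) \<subseteq> segment_subsets"
    using assms by (auto simp: inj_on_def)
  then show ?thesis
    using card_of_ordLeq by blast
qed

text \<open>If the sum had size k < m, then 2^k would be one of its summands, giving 2^k \<le> k
  against Cantor.\<close>

lemma ordLeq_segment_subsets: "m \<le>o |segment_subsets|"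
proof (rule ccontr)
  assume "\<not> m \<le>o |segment_subsets|"
  moreover have "Well_order m"
    using m card_order_on_well_order_on by blast
  ultimately have "|segment_subsets| <o m"
    using not_ordLeq_iff_ordLess[OF card_of_Well_order] by blast
  then obtain c where c: "c \<in> cardinals_below m" "|segment_subsets| =o |underS m c|"
    using ex_cardinals_below by blast
  then have "|Pow (underS m c)| \<le>o |underS m c|"
    using Pow_underS_ordLeq_segment_subsets ordLeq_ordIso_trans by blast
  then show False
    using card_of_Pow not_ordLess_ordLeq by blast
qed

lemma Field_ordLeq_segment_subsets: "|Field m| \<le>o |segment_subsets|"
  using ordIso_ordLeq_trans[OF card_of_Field_ordIso ordLeq_segment_subsets] m by blast

lemma infinite_segment_subsets: "infinite segment_subsets"
  using card_of_ordLeq_infinite[OF Field_ordLeq_segment_subsets infinite_Field] .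

text \<open>Summing over all levels instead of cardinals only repeats summands: there are
  \<open>m\<close> levels, each term is at most 2^{<m}, and \<open>m\<close> itself is at most
  2^{<m}.\<close>

lemma card_Sigma_underS: "|SIGMA a : Field m. Pow (underS m a)| =o weak_two_power m"
proof -
  have "|Pow (underS m a)| \<le>o |segment_subsets|" if "a \<in> Field m" for a
  proof -
    \<comment> \<open>Proper initial segments of a cardinal order have smaller cardinality.\<close>
    have "|underS m a| <o m"
      using m that by (intro card_of_underS) simp_all
    then obtain c where c: "c \<in> cardinals_below m" "|underS m a| =o |underS m c|"
      using ex_cardinals_below by blast
    then show ?thesis
      using ordIso_ordLeq_trans[OF card_of_Pow_cong[OF c(2)] Pow_underS_ordLeq_segment_subsets[OF c(1)]] by simp
  qed
  then have "|SIGMA a : Field m. Pow (underS m a)| \<le>o |segment_subsets|"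
    by (intro card_of_Sigma_ordLeq_infinite[OF infinite_segment_subsets Field_ordLeq_segment_subsets] ballI)
  moreover have "segment_subsets \<subseteq> (SIGMA a : Field m. Pow (underS m a))"
    by (auto simp: cardinals_below_def)
  then have "|segment_subsets| \<le>o |SIGMA a : Field m. Pow (underS m a)|"
    by (rule card_of_mono1)
  ultimately have "|SIGMA a : Field m. Pow (underS m a)| =o |segment_subsets|"
    by (simp add: ordIso_iff_ordLeq)
  then show ?thesis
    by (rule ordIso_transitive[OF _ weak_two_power_eq])
qed

lemma infinite_Sigma_underS: "infinite (SIGMA a : Field m. Pow (underS m a))" (is "infinite ?S")
proof -
  have "segment_subsets \<subseteq> ?S"
    by (auto simp: cardinals_below_def)
  then show ?thesis
    by (rule infinite_super[OF _ infinite_segment_subsets])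
qed

lemma card_Fpow_tree_nodes: "|Fpow (tree_nodes m)| =o weak_two_power m"
proof -
  let ?S = "SIGMA a : Field m. Pow (underS m a)"
  have le: "|Some ` ?S| \<le>o |?S|"
    by (rule card_of_image)
  have "|{None} \<union> Some ` ?S| \<le>o |?S|"
  proof (rule card_of_Un_ordLeq_infinite[OF infinite_Sigma_underS _ le])
    show "|{None :: ('b \<times> 'b set) option}| \<le>o |?S|"
      using infinite_Sigma_underS by (intro card_of_singl_ordLeq) auto
  qed
  then have "|tree_nodes m| \<le>o |?S|"
    by (simp add: tree_nodes_def)
  moreover have ge: "|?S| \<le>o |tree_nodes m|"
  proof -
    have "inj_on Some ?S" "Some ` ?S \<subseteq> tree_nodes m"
      by (auto simp: tree_nodes_def)
    then show ?thesis
      using card_of_ordLeq by blast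
  qed
  ultimately have "|tree_nodes m| =o |?S|"
    by (simp add: ordIso_iff_ordLeq)
  moreover have "|Fpow (tree_nodes m)| =o |tree_nodes m|"
    using card_of_ordLeq_infinite[OF ge infinite_Sigma_underS] by (rule card_of_Fpow_infinite)
  ultimately show ?thesis
    using ordIso_transitive[OF ordIso_transitive card_Sigma_underS] by blast
qed

text \<open>There are \<open>m\<close> levels, each with at most 2^m nodes. This lets the first
  factor absorb the second in the size of the group.\<close>

lemma weak_two_power_ordLeq: "weak_two_power m \<le>o |Pow (Field m)|"
proof -
  have "|SIGMA a : Field m. Pow (underS m a)| \<le>o |Pow (Field m)|"
  proof (rule card_of_Sigma_ordLeq_infinite)
    show "infinite (Pow (Field m))"
      using infinite_Field by simp
    show "|Field m| \<le>o |Pow (Field m)|"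
      using card_of_Pow ordLess_imp_ordLeq by blast
    show "\<forall>a \<in> Field m. |Pow (underS m a)| \<le>o |Pow (Field m)|"
      by (auto intro!: card_of_mono1 simp: underS_def Field_def)
  qed
  then show ?thesis
    by (rule ordIso_ordLeq_trans[OF ordIso_symmetric[OF card_Sigma_underS]])
qed

lemma card_Fpow_Times: "|Fpow (Pow (Field m)) \<times> Fpow (tree_nodes m)| =o |Pow (Field m)|"
proof -
  have P: "|Fpow (Pow (Field m))| =o |Pow (Field m)|"
    using infinite_Field by (intro card_of_Fpow_infinite) simp
  have inf: "infinite (Fpow (Pow (Field m)))"
    using card_of_ordIso_finite[OF P] infinite_Field by simp
  have "|Fpow (tree_nodes m)| \<le>o |Pow (Field m)|"
    using ordIso_ordLeq_trans[OF card_Fpow_tree_nodes weak_two_power_ordLeq] .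
  then have "|Fpow (tree_nodes m)| \<le>o |Fpow (Pow (Field m))|"
    by (rule ordLeq_ordIso_trans[OF _ ordIso_symmetric[OF P]])
  then have "|Fpow (Pow (Field m)) \<times> Fpow (tree_nodes m)| =o |Fpow (Pow (Field m))|"
    using inf Fpow_not_empty by (intro card_of_Times_infinite_simps)
  then show ?thesis
    by (rule ordIso_transitive[OF _ P])
qed

end

section \<open>The 2-group with few involutions\<close>

lemma ex_two_group:
  fixes m :: "'b rel"
  assumes m: "Cinfinite m"
  shows "\<exists>G :: 'b set monoid. p_group 2 G \<and> nilpotent_of_class G 2 \<and>
    |carrier G| =o ctwo ^c m \<and> |Omega1 2 G| =o weak_two_power m"
proof -
  have "Well_order m"
    using m card_order_on_well_order_on by blast
  moreover have "Field m \<noteq> {}"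
    using infinite_Field[OF m] by auto
  ultimately interpret anisotropic_pairing "meet_node m" "Pow (Field m)" "tree_nodes m"
    by (rule anisotropic_pairing_meet_node)
  have "|carrier G| =o |Pow (Field m)|"
    unfolding carrier_G by (rule card_Fpow_Times[OF m])
  \<comment> \<open>The elements constructed so far are pairs of sets of branches and nodes. A
    bijection onto \<open>Pow (Field m)\<close> moves the group structure to the type
    \<open>'b set\<close>.\<close>
  then obtain f where f: "bij_betw f (carrier G) (Pow (Field m))"
    unfolding card_of_ordIso[symmetric] ..
  let ?H = "image_group f G"
  have inj: "inj_on f (carrier G)"
    using f by (rule bij_betw_imp_inj_on)
  have H: "group ?H" and iso: "f \<in> iso G ?H"
    using inj by (rule inj_imp_image_group_is_group, rule inj_imp_image_group_iso)
  have "carrier ?H = Pow (Field m)"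
    using f by (simp only: image_group_carrier bij_betw_def)
  then have "|carrier ?H| =o ctwo ^c m"
    by (simp only: card_Pow_Field)
  moreover have "|Omega1 2 ?H| =o weak_two_power m"
  proof -
    have "Z \<subseteq> carrier G"
      by (rule subgroup.subset[OF subgroup_Z])
    then have "inj_on f Z"
      by (rule inj_on_subset[OF inj])
    \<comment> \<open>The first component is constant on \<open>Z\<close>, so \<open>Z\<close> has
      as many elements as \<open>Fpow (tree_nodes m)\<close>.\<close>
    then have "bij_betw (\<lambda>S. f ({}, S)) (Fpow (tree_nodes m)) (f ` Z)"
      by (auto simp: bij_betw_def inj_on_def)
    then have "|Fpow (tree_nodes m)| =o |Omega1 2 ?H|"
      unfolding iso_Omega1[OF group_G H iso] Omega1_G card_of_ordIso[symmetric] by blast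
    then show ?thesis
      by (rule ordIso_transitive[OF ordIso_symmetric card_Fpow_tree_nodes[OF m]])
  qed
  ultimately show ?thesis
    using iso_p_group[OF group_G H iso p_group_G] iso_nilpotent_of_class[OF group_G H iso nilpotent_G]
    by blast
qed

theorem theorem4p7:
  shows "(\<forall>(p::nat) (G :: ('a, 'x) monoid_scheme).
            prime p \<and> odd p \<and> p_group p G \<and> nilpotent_of_class G 2 \<and> uncountable (carrier G)
            \<longrightarrow> |Omega1 p G| =o |carrier G| )
       \<and> (\<forall>m :: 'b rel. Cinfinite m \<longrightarrow>
            (\<exists>G :: 'b set monoid.
               p_group 2 G \<and> nilpotent_of_class G 2 \<and>
               |carrier G| =o ctwo ^c m \<and> |Omega1 2 G| =o weak_two_power m))"
proof (intro conjI allI impI)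
  fix p :: nat and G :: "('a, 'x) monoid_scheme"
  assume "prime p \<and> odd p \<and> p_group p G \<and> nilpotent_of_class G 2 \<and> uncountable (carrier G)"
  then show "|Omega1 p G| =o |carrier G|"
    by (intro card_Omega1_odd) simp_all
next
  fix m :: "'b rel"
  assume "Cinfinite m"
  then show "\<exists>G :: 'b set monoid. p_group 2 G \<and> nilpotent_of_class G 2 \<and>
      |carrier G| =o ctwo ^c m \<and> |Omega1 2 G| =o weak_two_power m"
    by (rule ex_two_group)
qed

end
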